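(* Let $n, t\geq 3$. Then \[\operatorname{M}(C_{t}\times K_n)=\operatorname{Z}(C_{t}\times K_n)=\begin{cases} (n-2)t+2 & \text{if $t$ is odd,}\\ (n-2)t+4 & \text{if $t$ is even.}\end{cases}\]
   Context: All graphs are finite, simple and undirected. $C_t$ is the cycle on $t$ vertices and $K_n$ the complete graph on $n$ vertices. The tensor product $G\times H$ has vertex set $V(G)\times V(H)$, with $(g,h)$ adjacent to $(g',h')$ iff $g\sim g'$ in $G$ and $h\sim h'$ in $H$. For a graph $G$ on vertex set $\{1,\dots,N\}$, $\mathcal{S}(G)$ is the set of real symmetric $N\times N$ matrices $A=[a_{ij}]$ such that for $i\neq j$, $a_{ij}\neq 0$ iff $\{i,j\}$ is an edge of $G$ (diagonal entries are arbitrary); the maximum nullity is $\operatorname{M}(G)=\max\{\operatorname{null} A: A\in\mathcal{S}(G)\}$. Zero forcing: vertices are colored blue or white; if a blue vertex $u$ has exactly one white neighbor $w$, then $w$ is changed to blue. A zero forcing set is a set $B$ of vertices such that, coloring $B$ blue and all others white, repeated application of this rule colors all vertices blue; $\operatorname{Z}(G)$ is the minimum cardinality of a zero forcing set. *)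

theory Defs
  imports
    "Jordan_Normal_Form.Matrix_Kernel"
    "Graph_Theory.Graph_Theory"
begin

text \<open>
  A finite simple undirected graph is a \<open>pair_graph\<close>: a finite digraph without loops whose arc
  relation is symmetric, so that an edge \<open>{u, v}\<close> is represented by the two arcs
  \<open>(u, v)\<close> and \<open>(v, u)\<close>.
\<close>

definition cycle_graph :: "nat \<Rightarrow> nat pair_pre_digraph" where
  "cycle_graph t = \<lparr> pverts = {0..<t},
     parcs = {(i, j). i < t \<and> j < t \<and> (j = (i + 1) mod t \<or> i = (j + 1) mod t)} \<rparr>"

definition complete_graph :: "nat \<Rightarrow> nat pair_pre_digraph" where
  "complete_graph n = \<lparr> pverts = {0..<n}, parcs = {(i, j). i < n \<and> j < n \<and> i \<noteq> j} \<rparr>"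

definition tensor_graph ::
    "'a pair_pre_digraph \<Rightarrow> 'b pair_pre_digraph \<Rightarrow> ('a \<times> 'b) pair_pre_digraph" where
  "tensor_graph G H = \<lparr> pverts = pverts G \<times> pverts H,
     parcs = {((g, h), (g', h')). (g, g') \<in> parcs G \<and> (h, h') \<in> parcs H} \<rparr>"

lemma pair_graphI:
  assumes fin: "finite (pverts G)"
    and sub: "\<And>u v. (u, v) \<in> parcs G \<Longrightarrow> u \<in> pverts G \<and> v \<in> pverts G"
    and irr: "\<And>u. (u, u) \<notin> parcs G"
    and sym: "\<And>u v. (u, v) \<in> parcs G \<Longrightarrow> (v, u) \<in> parcs G"
  shows "pair_graph G"
proof unfold_locales
  show "finite (parcs G)"
    by (rule finite_subset[of _ "pverts G \<times> pverts G"]) (use fin sub in auto)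
  show "symmetric (with_proj G)"
    by (auto simp: symmetric_def intro!: symI sym)
  show "fst e \<noteq> snd e" if "e \<in> parcs G" for e
    using that irr by (cases e) auto
  show "fst e \<in> pverts G" "snd e \<in> pverts G" if "e \<in> parcs G" for e
    using that sub by (cases e; auto)+
qed (rule fin)

lemma pair_graph_arcD:
  assumes "pair_graph G" "(u, v) \<in> parcs G"
  shows "u \<in> pverts G" "v \<in> pverts G" "u \<noteq> v" "(v, u) \<in> parcs G"
proof -
  interpret pair_graph G by fact
  show "u \<in> pverts G" "v \<in> pverts G" "u \<noteq> v"
    using assms(2) arc_fst_in_verts arc_snd_in_verts pair_no_loops by fastforce+
  show "(v, u) \<in> parcs G"
    using assms(2) pair_sym_arcs by (auto simp: symmetric_def dest: symD)
qed

lemma pair_graph_cycle_graph: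
  assumes t: "t \<ge> 3"
  shows "pair_graph (cycle_graph t)"
proof (rule pair_graphI)
  have "u \<noteq> (u + 1) mod t" if "u < t" for u
    using that t by (cases "u + 1 = t") auto
  then show "(u, u) \<notin> parcs (cycle_graph t)" for u
    unfolding cycle_graph_def by (metis (mono_tags, lifting) case_prodD mem_Collect_eq pair_pre_digraph.select_convs(2))
qed (auto simp: cycle_graph_def)

lemma pair_graph_complete_graph: "pair_graph (complete_graph n)"
  by (rule pair_graphI) (auto simp: complete_graph_def)

lemma complete_digraph_complete_graph: "K\<^bsub>n\<^esub> (with_proj (complete_graph n))"
  unfolding complete_digraph_pair_def by (auto simp: complete_graph_def)

lemma pair_graph_tensor_graph:
  assumes G: "pair_graph G" and H: "pair_graph H"
  shows "pair_graph (tensor_graph G H)"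
proof (rule pair_graphI)
  interpret G: pair_graph G by fact
  interpret H: pair_graph H by fact
  show "finite (pverts (tensor_graph G H))"
    by (simp add: tensor_graph_def)
qed (auto simp: tensor_graph_def dest: pair_graph_arcD[OF G] pair_graph_arcD[OF H])

text \<open>
  The rows and columns of a matrix described by \<open>G\<close> are indexed by \<open>{0..<N}\<close>, where \<open>N\<close> is the
  number of vertices, through an enumeration \<open>f\<close> of the vertices. All enumerations are admitted;
  two of them yield matrices that differ by a simultaneous permutation of rows and columns, which
  affects neither the symmetry nor the nullity.
\<close>

definition described_by :: "'a pair_pre_digraph \<Rightarrow> (nat \<Rightarrow> 'a) \<Rightarrow> real mat \<Rightarrow> bool" where
  "described_by G f A \<longleftrightarrow>
     A \<in> carrier_mat (card (pverts G)) (card (pverts G)) \<and>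
     transpose_mat A = A \<and>
     (\<forall>i < card (pverts G). \<forall>j < card (pverts G). i \<noteq> j \<longrightarrow>
        (A $$ (i, j) \<noteq> 0 \<longleftrightarrow> (f i, f j) \<in> parcs G))"

definition symmetric_mats :: "'a pair_pre_digraph \<Rightarrow> real mat set" where
  "symmetric_mats G =
     {A. \<exists>f. bij_betw f {0..<card (pverts G)} (pverts G) \<and> described_by G f A}"

definition max_nullity :: "'a pair_pre_digraph \<Rightarrow> nat" where
  "max_nullity G = Max (kernel_dim ` symmetric_mats G)"

lemma finite_nullities: "finite (kernel_dim ` symmetric_mats G)"
proof (rule finite_subset)
  show "kernel_dim ` symmetric_mats G \<subseteq> {..card (pverts G)}"
    by (auto simp: symmetric_mats_def described_by_def kernel_dim_code)
qed simp

lemma symmetric_mats_nonempty: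
  assumes "pair_graph G"
  shows "symmetric_mats G \<noteq> {}"
proof -
  interpret pair_graph G by fact
  let ?N = "card (pverts G)"
  obtain f where f: "bij_betw f {0..<?N} (pverts G)"
    using ex_bij_betw_nat_finite[OF pair_finite_verts] by blast
  have s: "(f i, f j) \<in> parcs G \<longleftrightarrow> (f j, f i) \<in> parcs G" for i j
    using pair_graph_arcD(4)[OF assms] by blast
  let ?A = "mat ?N ?N (\<lambda>(i, j). if (f i, f j) \<in> parcs G then 1 else 0 :: real)"
  have "transpose_mat ?A = ?A"
    by (rule eq_matI) (auto simp: s)
  then have "described_by G f ?A"
    by (auto simp: described_by_def)
  with f show ?thesis by (auto simp: symmetric_mats_def)
qed

definition white_neighbors :: "'a pair_pre_digraph \<Rightarrow> 'a set \<Rightarrow> 'a \<Rightarrow> 'a set" where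
  "white_neighbors G B u = {v \<in> pverts G. (u, v) \<in> parcs G \<and> v \<notin> B}"

text \<open>One application of the color change rule to the set of blue vertices.\<close>

definition forces :: "'a pair_pre_digraph \<Rightarrow> 'a set \<Rightarrow> 'a set \<Rightarrow> bool" where
  "forces G B B' \<longleftrightarrow> (\<exists>u \<in> B. \<exists>w. white_neighbors G B u = {w} \<and> B' = insert w B)"

definition zero_forcing_set :: "'a pair_pre_digraph \<Rightarrow> 'a set \<Rightarrow> bool" where
  "zero_forcing_set G B \<longleftrightarrow> B \<subseteq> pverts G \<and> (forces G)\<^sup>*\<^sup>* B (pverts G)"

definition zero_forcing_number :: "'a pair_pre_digraph \<Rightarrow> nat" where
  "zero_forcing_number G = Min (card ` {B. zero_forcing_set G B})"

lemma finite_zero_forcing_sets: "finite (pverts G) \<Longrightarrow> finite {B. zero_forcing_set G B}"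
  by (rule finite_subset[of _ "Pow (pverts G)"]) (auto simp: zero_forcing_set_def)

lemma zero_forcing_set_pverts: "zero_forcing_set G (pverts G)"
  by (simp add: zero_forcing_set_def)

end

theory Submission
  imports Defs "Jordan_Normal_Form.DL_Rank"
begin

text \<open>
  A null vector of a matrix in \<open>S(G)\<close> that vanishes on a zero forcing set vanishes everywhere, so
  \<open>M(G) \<le> Z(G)\<close> always, and it suffices to exhibit a zero forcing set and a matrix that meet at the
  claimed value. For the matrix take the Kronecker product of the skew adjacency matrix of the
  directed cycle and the skew matrix \<open>(h - h')\<close> of rank 2: it is symmetric, and a vector is in its
  kernel as soon as its column sums \<open>p\<^sub>i\<close> and weighted column sums \<open>q\<^sub>i\<close> satisfy
  \<open>p\<^sub>i\<^sub>+\<^sub>2 = p\<^sub>i\<close> and \<open>q\<^sub>i\<^sub>+\<^sub>2 = q\<^sub>i\<close> around the cycle, which amounts to \<open>2(t - 1)\<close> or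
  \<open>2(t - 2)\<close> equations for odd or even \<open>t\<close>. For forcing, two full columns plus all but two vertices
  of every other column always suffice. For odd \<open>t\<close>, two columns with one white vertex each, at
  different heights, already suffice: forcing once around the cycle leaves one white vertex per
  column, at alternating heights, and the parity clash at the seam allows a second round.
\<close>

section \<open>Kernel dimension under added equations\<close>

lemma kernel_fin_dim:
  fixes A :: "'a :: field mat"
  assumes A: "A \<in> carrier_mat nr nc"
  shows "vectorspace.fin_dim class_ring (module_vec TYPE('a) nc\<lparr>carrier := mat_kernel A\<rparr>)"
proof -
  interpret K: kernel nr nc A by unfold_locales (rule A)
  from kernel_basis_exists[OF A] obtain B where "finite B" "K.basis B" by blast
  then show ?thesis unfolding K.Ker.fin_dim_def K.Ker.basis_def by auto
qed

text \<open>A basis of the smaller kernel stays linearly independent in the larger one, as both lie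
  in the same coordinate space.\<close>

lemma kernel_dim_mono:
  fixes A C :: "'a :: field mat"
  assumes A: "A \<in> carrier_mat nr nc" and C: "C \<in> carrier_mat mr nc"
    and sub: "mat_kernel A \<subseteq> mat_kernel C"
  shows "kernel_dim A \<le> kernel_dim C"
proof -
  interpret A: kernel nr nc A by unfold_locales (rule A)
  interpret C: kernel mr nc C by unfold_locales (rule C)
  from kernel_basis_exists[OF A] obtain B where B: "finite B" "A.basis B" by blast
  then have BA: "B \<subseteq> mat_kernel A" and li: "A.lin_indpt B"
    unfolding A.Ker.basis_def by auto
  have "C.lin_indpt B"
    using li A.lindep_same[OF BA] C.lindep_same[of B] BA sub by auto
  then have "card B \<le> C.dim"
    using C.Ker.li_le_dim(2)[of B] kernel_fin_dim[OF C] BA sub by auto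
  then show ?thesis using A.Ker.dim_basis[OF B] by simp
qed

lemma mat_kernel_append_rows:
  fixes A C :: "'a :: comm_ring_1 mat"
  assumes A: "A \<in> carrier_mat nr nc" and C: "C \<in> carrier_mat r nc"
  shows "mat_kernel (A @\<^sub>r C) = mat_kernel A \<inter> mat_kernel C"
proof -
  have AC: "A @\<^sub>r C \<in> carrier_mat (nr + r) nc" using A C by simp
  have "(A @\<^sub>r C) *\<^sub>v v = 0\<^sub>v (nr + r) \<longleftrightarrow> A *\<^sub>v v = 0\<^sub>v nr \<and> C *\<^sub>v v = 0\<^sub>v r"
    if "v \<in> carrier_vec nc" for v
  proof -
    have "0\<^sub>v (nr + r) = 0\<^sub>v nr @\<^sub>v (0\<^sub>v r :: 'a vec)" by (rule eq_vecI) auto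
    moreover have "A *\<^sub>v v \<in> carrier_vec nr" using A by (intro carrier_vecI) simp
    ultimately show ?thesis
      by (metis append_vec_eq zero_carrier_vec mat_mult_append[OF A C that])
  qed
  then show ?thesis
    unfolding mat_kernel[OF AC] mat_kernel[OF A] mat_kernel[OF C] by blast
qed

text \<open>Rank-nullity for \<open>v \<mapsto> C v\<close> restricted to the kernel of
  \<open>A\<close>: its kernel is that of the stacked matrix, and its image lies in a space of
  dimension \<open>r\<close>.\<close>

lemma kernel_dim_append_rows:
  fixes A C :: "'a :: field mat"
  assumes A: "A \<in> carrier_mat nr nc" and C: "C \<in> carrier_mat r nc"
  shows "kernel_dim A \<le> r + kernel_dim (A @\<^sub>r C)"
proof -
  interpret A: kernel nr nc A by unfold_locales (rule A)
  interpret W: vec_space "TYPE('a)" r .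
  have AC: "A @\<^sub>r C \<in> carrier_mat (nr + r) nc" using A C by simp
  interpret AC: kernel "nr + r" nc "A @\<^sub>r C" by unfold_locales (rule AC)
  let ?T = "\<lambda>v. C *\<^sub>v v"
  have car: "v \<in> carrier_vec nc" if "v \<in> mat_kernel A" for v
    using that mat_kernelD[OF A] by auto
  have hom: "?T \<in> LinearCombinations.module_hom class_ring A.VK W.V"
    unfolding LinearCombinations.module_hom_def using C
    by (auto simp: mult_add_distrib_mat_vec[OF C] mult_mat_vec[OF C] car module_vec_simps class_ring_simps)
  interpret T: linear_map class_ring A.VK W.V ?T
    by unfold_locales (rule hom)
  have ker: "T.kerT = mat_kernel (A @\<^sub>r C)"
    unfolding mat_kernel_append_rows[OF A C] T.ker_def using car
    by (auto simp: mat_kernel[OF C] module_vec_simps)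
  have im: "VectorSpace.subspace class_ring T.imT W.V" by (rule T.imT_is_subspace)
  interpret I: vectorspace class_ring "W.vs T.imT" by (rule W.subspace_is_vs[OF im])
  have homI: "?T \<in> LinearCombinations.module_hom class_ring A.VK (W.vs T.imT)"
    using hom unfolding LinearCombinations.module_hom_def T.im_def by auto
  interpret TI: linear_map class_ring A.VK "W.vs T.imT" ?T
    by unfold_locales (rule homI)
  have fd: "A.Ker.fin_dim" by (rule kernel_fin_dim[OF A])
  have "I.fin_dim"
    by (rule TI.surj_fin_dim) (use fd in \<open>auto simp: T.im_def\<close>)
  then have "I.dim \<le> r"
    using W.subspace_dim[OF im] W.dim_is_n by simp
  then show ?thesis
    using T.rank_nullity fd unfolding ker by simp
qed

text \<open>Serves both bounds: with \<open>D\<close> the identity it bounds a nullity from above by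
  \<open>r\<close>; with \<open>A\<close> a matrix without rows it bounds the nullity of
  \<open>D\<close> from below.\<close>

lemma kernel_dim_le_add_rows:
  fixes A C D :: "'a :: field mat"
  assumes A: "A \<in> carrier_mat nr nc" and C: "C \<in> carrier_mat r nc" and D: "D \<in> carrier_mat mr nc"
    and sub: "mat_kernel A \<inter> mat_kernel C \<subseteq> mat_kernel D"
  shows "kernel_dim A \<le> r + kernel_dim D"
proof -
  have AC: "A @\<^sub>r C \<in> carrier_mat (nr + r) nc" using A C by simp
  have "kernel_dim (A @\<^sub>r C) \<le> kernel_dim D"
    using kernel_dim_mono[OF AC D] sub mat_kernel_append_rows[OF A C] by simp
  then show ?thesis using kernel_dim_append_rows[OF A C] by simp
qed

section \<open>Zero forcing as an upper bound for the nullity\<close>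

text \<open>When \<open>u\<close> forces \<open>w\<close>, row \<open>u\<close> of
  \<open>A v = 0\<close> reduces to a nonzero multiple of the entry of \<open>v\<close> at
  \<open>w\<close>. Vanishing thus spreads from \<open>B\<close> to all vertices, so
  \<open>card B\<close> extra equations make the kernel trivial.\<close>

lemma kernel_dim_le_zero_forcing_set:
  assumes G: "pair_graph G" and A: "A \<in> symmetric_mats G" and B: "zero_forcing_set G B"
  shows "kernel_dim A \<le> card B"
proof -
  let ?N = "card (pverts G)"
  from A obtain f where f: "bij_betw f {0..<?N} (pverts G)" and d: "described_by G f A"
    by (auto simp: symmetric_mats_def)
  from d have Ac: "A \<in> carrier_mat ?N ?N"
    and Anz: "\<And>i j. i < ?N \<Longrightarrow> j < ?N \<Longrightarrow> i \<noteq> j \<Longrightarrow> A $$ (i, j) \<noteq> 0 \<longleftrightarrow> (f i, f j) \<in> parcs G"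
    by (auto simp: described_by_def)
  have ex_index: "\<exists>i < ?N. f i = x" if "x \<in> pverts G" for x
  proof -
    from that have "x \<in> f ` {0..<?N}" by (simp only: bij_betw_imp_surj_on[OF f])
    then show ?thesis by auto
  qed
  \<comment> \<open>The rows of \<open>C\<close> are the unit vectors at the blue indices, so the
    kernel of \<open>C\<close> consists of the vectors that vanish on \<open>B\<close>.\<close>
  define bs where "bs = filter (\<lambda>j. f j \<in> B) [0..<?N]"
  define C where "C = mat_of_rows ?N (map (unit_vec ?N) bs :: real vec list)"
  have C: "C \<in> carrier_mat (length bs) ?N" by (auto simp: C_def)
  have "f ` {j. j < ?N \<and> f j \<in> B} = f ` {0..<?N} \<inter> B" by auto
  then have "f ` {j. j < ?N \<and> f j \<in> B} = B"
    using f B by (auto simp: bij_betw_def zero_forcing_set_def)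
  moreover have "inj_on f {j. j < ?N \<and> f j \<in> B}"
    using f by (auto simp: bij_betw_def intro: inj_on_subset)
  ultimately have "card {j. j < ?N \<and> f j \<in> B} = card B"
    by (metis card_image)
  moreover have "length bs = card {j. j < ?N \<and> f j \<in> B}"
    unfolding bs_def length_filter_conv_card by (rule arg_cong[of _ _ card]) auto
  ultimately have len: "length bs = card B" by simp
  have "v = 0\<^sub>v ?N" if vA: "v \<in> mat_kernel A" and vC: "v \<in> mat_kernel C" for v
  proof -
    from mat_kernelD[OF Ac vA] have v: "v \<in> carrier_vec ?N" and Av: "A *\<^sub>v v = 0\<^sub>v ?N" by auto
    from mat_kernelD[OF C vC] have Cv: "C *\<^sub>v v = 0\<^sub>v (length bs)" by auto
    have zero_on_B: "v $ j = 0" if "j < ?N" "f j \<in> B" for j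
    proof -
      from that have "j \<in> set bs" by (auto simp: bs_def)
      then obtain k where k: "k < length bs" "bs ! k = j" by (auto simp: in_set_conv_nth)
      then have "(C *\<^sub>v v) $ k = v $ j"
        using v that by (simp add: C_def scalar_prod_left_unit)
      then show ?thesis using Cv k by simp
    qed
    have "\<forall>j < ?N. f j \<in> S \<longrightarrow> v $ j = 0" if "(forces G)\<^sup>*\<^sup>* B S" for S
      using that
    proof (induction rule: rtranclp_induct)
      case base
      show ?case using zero_on_B by blast
    next
      case (step S S')
      from step.hyps(2) obtain u w where u: "u \<in> S" and w: "white_neighbors G S u = {w}"
        and S': "S' = insert w S" by (auto simp: forces_def)
      from w have arc: "(u, w) \<in> parcs G" by (auto simp: white_neighbors_def)
      from pair_graph_arcD[OF G arc] have uv: "u \<in> pverts G" "w \<in> pverts G" "u \<noteq> w" by auto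
      then obtain i k where i: "i < ?N" "f i = u" and k: "k < ?N" "f k = w"
        using ex_index by meson
      \<comment> \<open>Blue positions, among them the diagonal one as \<open>u\<close> is blue,
        have \<open>v $ j = 0\<close>; at a white position other than \<open>w\<close> the matrix
        entry is zero.\<close>
      have zero: "A $$ (i, j) * v $ j = 0" if j: "j < ?N" "j \<noteq> k" for j
      proof (cases "f j \<in> S")
        case True
        then show ?thesis using step.IH j by simp
      next
        case False
        have "f j \<noteq> w" using f j k by (auto simp: bij_betw_def inj_on_def)
        moreover have "f j \<in> pverts G" using f j by (auto simp: bij_betw_def)
        ultimately have "(u, f j) \<notin> parcs G" using w False by (auto simp: white_neighbors_def)
        moreover have "j \<noteq> i" using False u i by auto
        ultimately show ?thesis using Anz[OF i(1) j(1)] i by auto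
      qed
      have "0 = (A *\<^sub>v v) $ i" using Av i by simp
      also have "\<dots> = (\<Sum>j = 0..<?N. A $$ (i, j) * v $ j)"
        using Ac v i by (auto simp: scalar_prod_def intro!: sum.cong)
      also have "\<dots> = A $$ (i, k) * v $ k"
      proof -
        have "(\<Sum>j \<in> {0..<?N} - {k}. A $$ (i, j) * v $ j) = 0"
          by (rule sum.neutral, rule ballI, rule zero) auto
        then show ?thesis
          using k(1) sum.remove[of "{0..<?N}" k "\<lambda>j. A $$ (i, j) * v $ j"] by simp
      qed
      finally have vk: "v $ k = 0" using Anz[OF i(1) k(1)] i k uv arc by auto
      show ?case
      proof (intro allI impI)
        fix j assume j: "j < ?N" "f j \<in> S'"
        show "v $ j = 0"
        proof (cases "f j \<in> S")
          case True
          then show ?thesis using step.IH j(1) by simp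
        next
          case False
          then have "f j = f k" using j(2) S' k(2) by simp
          then have "j = k"
            using inj_onD[OF bij_betw_imp_inj_on[OF f]] j(1) k(1) by simp
          then show ?thesis using vk by simp
        qed
      qed
    qed
    moreover have "(forces G)\<^sup>*\<^sup>* B (pverts G)" using B by (simp add: zero_forcing_set_def)
    moreover have "f j \<in> pverts G" if "j < ?N" for j
      using bij_betwE[OF f] that by simp
    ultimately have "v $ j = 0" if "j < ?N" for j using that by blast
    then show ?thesis using v by (intro eq_vecI) auto
  qed
  moreover have "0\<^sub>v ?N \<in> mat_kernel (1\<^sub>m ?N :: real mat)"
    by (simp add: mat_kernel_def)
  ultimately have "mat_kernel A \<inter> mat_kernel C \<subseteq> mat_kernel (1\<^sub>m ?N)" by blast
  from kernel_dim_le_add_rows[OF Ac C one_carrier_mat this]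
  have "kernel_dim A \<le> card B + kernel_dim (1\<^sub>m ?N :: real mat)" by (simp add: len)
  moreover have "kernel_dim (1\<^sub>m ?N :: real mat) = 0"
    unfolding kernel_dim_def using kernel_one_mat(1)[of ?N] by simp
  ultimately show ?thesis by simp
qed

text \<open>
  The closure does not record an order of the forces; any maximal sequence of forces reaches it.
\<close>

inductive_set forcing_closure :: "'a pair_pre_digraph \<Rightarrow> 'a set \<Rightarrow> 'a set"
  for G B where
  base: "x \<in> B \<Longrightarrow> x \<in> forcing_closure G B"
| step: "u \<in> forcing_closure G B \<Longrightarrow> (u, w) \<in> parcs G
    \<Longrightarrow> (\<And>v. (u, v) \<in> parcs G \<Longrightarrow> v \<noteq> w \<Longrightarrow> v \<in> forcing_closure G B)
    \<Longrightarrow> w \<in> forcing_closure G B"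

text \<open>Take a maximal set \<open>S\<close> reachable from \<open>B\<close>. A closure step
  leading out of \<open>S\<close> would be one more legal force, so \<open>S\<close> contains the
  closure.\<close>

lemma zero_forcing_setI:
  assumes G: "pair_graph G" and B: "B \<subseteq> pverts G" and cl: "pverts G \<subseteq> forcing_closure G B"
  shows "zero_forcing_set G B"
proof -
  interpret pair_graph G by fact
  let ?R = "{S. S \<subseteq> pverts G \<and> (forces G)\<^sup>*\<^sup>* B S}"
  have "finite ?R" by (rule finite_subset[of _ "Pow (pverts G)"]) auto
  moreover have "?R \<noteq> {}" using B by auto
  ultimately obtain S where S: "S \<in> ?R" and max: "\<And>T. T \<in> ?R \<Longrightarrow> S \<subseteq> T \<Longrightarrow> T = S"
    using finite_has_maximal[of ?R] by metis
  have "B \<subseteq> S"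
  proof -
    have "(forces G)\<^sup>*\<^sup>* B S" using S by simp
    then show ?thesis by (induction rule: rtranclp_induct) (auto simp: forces_def)
  qed
  have "x \<in> S" if "x \<in> forcing_closure G B" for x
    using that
  proof (induction rule: forcing_closure.induct)
    case (base x)
    then show ?case using \<open>B \<subseteq> S\<close> by auto
  next
    case (step u w)
    show ?case
    proof (rule ccontr)
      assume w: "w \<notin> S"
      have wv: "w \<in> pverts G" using pair_graph_arcD[OF G step.hyps(2)] by simp
      have "white_neighbors G S u = {w}"
        using w wv step by (auto simp: white_neighbors_def)
      then have "forces G S (insert w S)"
        using step.IH(1) by (auto simp: forces_def)
      then have "insert w S \<in> ?R" using S wv by auto
      then show False using max[of "insert w S"] w by auto
    qed
  qed
  then have "S = pverts G" using cl S by auto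
  then show ?thesis using S B by (simp add: zero_forcing_set_def)
qed

text \<open>Closes the chain \<open>kernel_dim A \<le> max_nullity G \<le> zero_forcing_number G
  \<le> card B\<close>.\<close>

lemma max_nullity_eq_zero_forcing_numberI:
  assumes G: "pair_graph G" and A: "A \<in> symmetric_mats G" and B: "zero_forcing_set G B"
    and le: "card B \<le> k" "k \<le> kernel_dim A"
  shows "max_nullity G = k" "zero_forcing_number G = k"
proof -
  interpret pair_graph G by fact
  have zf: "finite (card ` {B. zero_forcing_set G B})" "card ` {B. zero_forcing_set G B} \<noteq> {}"
    using finite_zero_forcing_sets[OF pair_finite_verts] B by auto
  have "zero_forcing_number G \<le> card B"
    unfolding zero_forcing_number_def by (rule Min_le) (use zf B in auto)
  moreover have "kernel_dim A \<le> max_nullity G"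
    unfolding max_nullity_def by (rule Max_ge) (use finite_nullities A in auto)
  moreover have "max_nullity G \<le> zero_forcing_number G"
  proof -
    have "max_nullity G \<in> kernel_dim ` symmetric_mats G"
      unfolding max_nullity_def by (rule Max_in) (use finite_nullities A in auto)
    moreover have "zero_forcing_number G \<in> card ` {B. zero_forcing_set G B}"
      unfolding zero_forcing_number_def by (rule Min_in) (use zf in auto)
    ultimately show ?thesis
      using kernel_dim_le_zero_forcing_set[OF G] by auto
  qed
  ultimately show "max_nullity G = k" "zero_forcing_number G = k" using le by linarith+
qed

section \<open>Zero forcing sets of the tensor product\<close>

abbreviation (input) cycle_complete_graph :: "nat \<Rightarrow> nat \<Rightarrow> (nat \<times> nat) pair_pre_digraph" where
  "cycle_complete_graph t n \<equiv> tensor_graph (cycle_graph t) (complete_graph n)"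

lemma pverts_cycle_complete: "pverts (cycle_complete_graph t n) = {0..<t} \<times> {0..<n}"
  by (simp add: tensor_graph_def cycle_graph_def complete_graph_def)

text \<open>Listing the wraparound arcs separately removes \<open>mod\<close> from the case analyses
  of neighbors below.\<close>

lemma parcs_cycle_graph:
  assumes "t \<ge> 3"
  shows "(i, j) \<in> parcs (cycle_graph t) \<longleftrightarrow> i < t \<and> j < t \<and>
    (j = Suc i \<or> i = Suc j \<or> i = 0 \<and> j = t - 1 \<or> i = t - 1 \<and> j = 0)"
proof -
  have "(k + 1) mod t = (if k = t - 1 then 0 else Suc k)" if "k < t" for k
    using that by auto
  then show ?thesis by (auto simp: cycle_graph_def split: if_splits)
qed

lemma parcs_cycle_complete:
  assumes "t \<ge> 3"
  shows "((i, h), (j, k)) \<in> parcs (cycle_complete_graph t n) \<longleftrightarrow>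
    i < t \<and> j < t \<and> h < n \<and> k < n \<and> h \<noteq> k \<and>
    (j = Suc i \<or> i = Suc j \<or> i = 0 \<and> j = t - 1 \<or> i = t - 1 \<and> j = 0)"
  using assms by (auto simp: tensor_graph_def complete_graph_def parcs_cycle_graph)

lemma pair_graph_cycle_complete: "t \<ge> 3 \<Longrightarrow> pair_graph (cycle_complete_graph t n)"
  by (intro pair_graph_tensor_graph pair_graph_cycle_graph pair_graph_complete_graph)

text \<open>Once the columns before \<open>i\<close> are blue, \<open>(i - 1, 0)\<close> is not
  adjacent to \<open>(i, 0)\<close> and so forces \<open>(i, 1)\<close>; symmetrically
  \<open>(i - 1, 1)\<close> forces \<open>(i, 0)\<close>. Starting at \<open>i = 2\<close> keeps the
  neighbors of column \<open>i - 1\<close> clear of the seam.\<close>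

lemma zero_forcing_set_two_columns:
  assumes t: "t \<ge> 3" and n: "n \<ge> 2"
  shows "zero_forcing_set (cycle_complete_graph t n) ({0..<t} \<times> {0..<n} - {2..<t} \<times> {0..<2})"
    (is "zero_forcing_set ?G ?B")
proof (rule zero_forcing_setI)
  show "pair_graph ?G" by (rule pair_graph_cycle_complete[OF t])
  show "?B \<subseteq> pverts ?G" by (auto simp: pverts_cycle_complete)
  let ?cl = "forcing_closure ?G ?B"
  note arc = parcs_cycle_complete[OF t]
  have "\<forall>h < n. (i, h) \<in> ?cl" if "i < t" for i
    using that
  proof (induction i rule: less_induct)
    case (less i)
    show ?case
    proof (cases "i < 2")
      case True
      then show ?thesis using less.prems by (auto intro!: forcing_closure.base)
    next
      case False
      have B: "(i, h) \<in> ?cl" if "2 \<le> h" "h < n" for h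
        using that less.prems by (auto intro!: forcing_closure.base)
      have 1: "(i, 1) \<in> ?cl"
      proof (rule forcing_closure.step[of "(i - 1, 0)"])
        show "(i - 1, 0) \<in> ?cl" using less False n by auto
        show "((i - 1, 0), (i, 1)) \<in> parcs ?G" using less.prems False n by (auto simp: arc)
        fix v assume v: "((i - 1, 0), v) \<in> parcs ?G" "v \<noteq> (i, 1)"
        obtain j h where jh: "v = (j, h)" by (cases v)
        from v False have "j = i \<and> 2 \<le> h \<and> h < n \<or> j < i \<and> j < t \<and> h < n"
          using less.prems by (auto simp: jh arc)
        then show "v \<in> ?cl" using less.IH B jh by auto
      qed
      have 0: "(i, 0) \<in> ?cl"
      proof (rule forcing_closure.step[of "(i - 1, 1)"])
        show "(i - 1, 1) \<in> ?cl" using less False n by auto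
        show "((i - 1, 1), (i, 0)) \<in> parcs ?G" using less.prems False n by (auto simp: arc)
        fix v assume v: "((i - 1, 1), v) \<in> parcs ?G" "v \<noteq> (i, 0)"
        obtain j h where jh: "v = (j, h)" by (cases v)
        from v False have "j = i \<and> 2 \<le> h \<and> h < n \<or> j < i \<and> j < t \<and> h < n"
          using less.prems by (auto simp: jh arc)
        then show "v \<in> ?cl" using less.IH B jh by auto
      qed
      have "h = 0 \<or> h = 1 \<or> 2 \<le> h" for h :: nat by auto
      then show ?thesis using 0 1 B by metis
    qed
  qed
  then show "pverts ?G \<subseteq> ?cl" by (auto simp: pverts_cycle_complete)
qed

text \<open>The trick is to force with a vertex at the same height as a white vertex two columns
  back from the target: equal heights are never adjacent, so that white vertex does not block the
  force.\<close>

lemma zero_forcing_set_alternating: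
  assumes t: "t \<ge> 3" and odd: "odd t" and n: "n \<ge> 2"
  shows "zero_forcing_set (cycle_complete_graph t n)
    ({0..<t} \<times> {0..<n} - ({2..<t} \<times> {0..<2} \<union> {(0, 0), (1, 1)}))"
    (is "zero_forcing_set ?G ?B")
proof (rule zero_forcing_setI)
  show "pair_graph ?G" by (rule pair_graph_cycle_complete[OF t])
  show "?B \<subseteq> pverts ?G" by (auto simp: pverts_cycle_complete)
  let ?cl = "forcing_closure ?G ?B"
  note arc = parcs_cycle_complete[OF t]
  have B: "(i, h) \<in> ?cl" if "2 \<le> h" "h < n" "i < t" for i h
    using that by (auto intro!: forcing_closure.base)
  have c2: "h = i mod 2 \<or> h = Suc i mod 2 \<or> 2 \<le> h" for h i :: nat
    by (cases "even i") (auto simp: odd_iff_mod_2_eq_one)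
  have ne: "i mod 2 \<noteq> Suc i mod 2" for i :: nat by presburger
  have lt: "i mod 2 < n" for i :: nat using n by (meson mod_less_divisor order_less_le_trans pos2)
  have "(i, Suc i mod 2) \<in> ?cl" if "i < t" for i
    using that
  proof (induction i rule: less_induct)
    case (less i)
    have *: "(j, h) \<in> ?cl" if "h \<noteq> j mod 2" "j < i" "h < n" for j h
      using that less c2[of h j] B[of h j] by auto
    show ?case
    proof (cases "i < 2")
      case True
      then have "i = 0 \<or> i = 1" by auto
      then show ?thesis using less.prems n by (auto intro!: forcing_closure.base)
    next
      case False
      then obtain k where k: "i = Suc (Suc k)" using that[of "i - 2"] by simp
      \<comment> \<open>The only height at which column \<open>k\<close> may be white is
        \<open>k mod 2\<close>, which equals \<open>i mod 2\<close>, the height of the forcing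
        vertex.\<close>
      show ?thesis
      proof (rule forcing_closure.step[of "(Suc k, i mod 2)"])
        show "(Suc k, i mod 2) \<in> ?cl" using * ne[of "Suc k"] lt[of i] k by auto
        show "((Suc k, i mod 2), (i, Suc i mod 2)) \<in> parcs ?G"
          using less.prems k ne[of i] lt by (auto simp: arc)
        fix v assume v: "((Suc k, i mod 2), v) \<in> parcs ?G" "v \<noteq> (i, Suc i mod 2)"
        obtain j h where jh: "v = (j, h)" by (cases v)
        from v have "j = i \<and> h < n \<and> h \<noteq> i mod 2 \<and> h \<noteq> Suc i mod 2 \<or> j = k \<and> h < n \<and> h \<noteq> j mod 2"
          using less.prems k by (auto simp: jh arc)
        then show "v \<in> ?cl" using * B c2[of h i] jh k less.prems by auto
      qed
    qed
  qed
  then have A: "(i, h) \<in> ?cl" if "h \<noteq> i mod 2" "i < t" "h < n" for i h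
    using that c2[of h i] B[of h i] by auto
  \<comment> \<open>Column \<open>i\<close> may now be white only at \<open>i mod 2\<close>; both columns \<open>t - 1\<close> and \<open>0\<close> at \<open>0\<close>, as \<open>t\<close> is odd.\<close>
  have l: "(t - 1, 0) \<in> ?cl"
  \<comment> \<open>The possibly white vertex \<open>(1, 1)\<close> has the same height as
    \<open>(0, 1)\<close> and does not block it.\<close>
  proof (rule forcing_closure.step[of "(0, 1)"])
    show "(0, 1) \<in> ?cl" using t n by (intro A) auto
    show "((0, 1), (t - 1, 0)) \<in> parcs ?G" using t n by (auto simp: arc)
    fix v assume v: "((0, 1), v) \<in> parcs ?G" "v \<noteq> (t - 1, 0)"
    obtain j h where jh: "v = (j, h)" by (cases v)
    from v have "h \<noteq> j mod 2 \<and> j < t \<and> h < n"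
      using t odd by (auto simp: jh arc)
    then show "v \<in> ?cl" using A jh by auto
  qed
  have lc: "(t - 1, h) \<in> ?cl" if "h < n" for h
    using l A[of h "t - 1"] that t odd by (cases "h = 0") auto
  have f: "(0, 0) \<in> ?cl"
  proof (rule forcing_closure.step[of "(t - 1, 1)"])
    show "(t - 1, 1) \<in> ?cl" using lc n by auto
    show "((t - 1, 1), (0, 0)) \<in> parcs ?G" using t n by (auto simp: arc)
    fix v assume v: "((t - 1, 1), v) \<in> parcs ?G" "v \<noteq> (0, 0)"
    obtain j h where jh: "v = (j, h)" by (cases v)
    \<comment> \<open>Column \<open>t - 2\<close> is odd, so it can be white only at height 1, the
      height of the forcing vertex.\<close>
    have "j mod 2 = 1" if "t - Suc 0 = Suc j" using that odd by presburger
    with v have "h \<noteq> j mod 2 \<and> j < t \<and> h < n"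
      using t by (auto simp: jh arc)
    then show "v \<in> ?cl" using A jh by auto
  qed
  \<comment> \<open>Second round: each column has at most one white vertex left, forced from the
    full column before it. For \<open>k = 0\<close> the other neighboring column is
    \<open>t - 1\<close>, already full by \<open>lc\<close>.\<close>
  have "\<forall>h < n. (i, h) \<in> ?cl" if "i < t" for i
    using that
  proof (induction i rule: less_induct)
    case (less i)
    have "(i, i mod 2) \<in> ?cl"
    proof (cases i)
      case 0
      then show ?thesis using f by simp
    next
      case (Suc k)
      show ?thesis
      proof (rule forcing_closure.step[of "(k, k mod 2)"])
        show "(k, k mod 2) \<in> ?cl" using less Suc lt by auto
        show "((k, k mod 2), (i, i mod 2)) \<in> parcs ?G"
          using less.prems Suc lt ne[of k] by (auto simp: arc)
        fix v assume v: "((k, k mod 2), v) \<in> parcs ?G" "v \<noteq> (i, i mod 2)"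
        obtain j h where jh: "v = (j, h)" by (cases v)
        from v have "h < n \<and> (j = t - 1 \<or> j < i \<and> j < t \<or> j = i \<and> h \<noteq> i mod 2 \<and> j < t)"
          using Suc less.prems by (auto simp: jh arc)
        then show "v \<in> ?cl" using lc A less jh by auto
      qed
    qed
    then show ?case using A less.prems by metis
  qed
  then show "pverts ?G \<subseteq> ?cl" by (auto simp: pverts_cycle_complete)
qed

lemma card_zero_forcing_set_two_columns:
  fixes t n :: nat
  assumes t: "t \<ge> 3" and n: "n \<ge> 2"
  shows "card ({0..<t} \<times> {0..<n} - {2..<t} \<times> {0..<2}) = (n - 2) * t + 4"
proof -
  have "card ({0..<t} \<times> {0..<n} - {2..<t} \<times> {0..<2}) = t * n - (t - 2) * 2"
    by (subst card_Diff_subset) (use t n in auto)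
  also have "\<dots> = (n - 2) * t + 4"
  proof -
    \<comment> \<open>The substitution eliminates truncated subtraction.\<close>
    obtain a b where "t = a + 3" "n = b + 2" using that[of "t - 3" "n - 2"] t n by simp
    then show ?thesis by (simp add: algebra_simps)
  qed
  finally show ?thesis .
qed

lemma card_zero_forcing_set_alternating:
  fixes t n :: nat
  assumes t: "t \<ge> 3" and n: "n \<ge> 2"
  shows "card ({0..<t} \<times> {0..<n} - ({2..<t} \<times> {0..<2} \<union> {(0, 0), (1, 1)})) = (n - 2) * t + 2"
proof -
  have "card ({2..<t} \<times> {0..<2::nat} \<union> {(0, 0), (1, 1)}) = (t - 2) * 2 + 2"
    by (subst card_Un_disjoint) auto
  then have "card ({0..<t} \<times> {0..<n} - ({2..<t} \<times> {0..<2} \<union> {(0, 0), (1, 1)})) = t * n - ((t - 2) * 2 + 2)"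
    by (subst card_Diff_subset) (use t n in auto)
  also have "\<dots> = (n - 2) * t + 2"
  proof -
    obtain a b where "t = a + 3" "n = b + 2" using that[of "t - 3" "n - 2"] t n by simp
    then show ?thesis by (simp add: algebra_simps)
  qed
  finally show ?thesis .
qed

section \<open>A symmetric matrix of large nullity\<close>

lemma sum_div_mod:
  fixes F :: "nat \<Rightarrow> nat \<Rightarrow> 'a :: comm_monoid_add"
  shows "(\<Sum>l = 0..<t * n. F (l div n) (l mod n)) = (\<Sum>j<t. \<Sum>h<n. F j h)"
proof -
  have "(\<Sum>l = 0..<t * n. F (l div n) (l mod n)) = (\<Sum>j<t. \<Sum>l = j * n..<j * n + n. F (l div n) (l mod n))"
    using sum.nat_group[of "\<lambda>l. F (l div n) (l mod n)" n t] by (simp add: lessThan_atLeast0)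
  also have "\<dots> = (\<Sum>j<t. \<Sum>h<n. F j h)"
  proof (rule sum.cong)
    fix j
    have "(\<Sum>l = j * n..<j * n + n. F (l div n) (l mod n)) = (\<Sum>h = 0..<n. F ((h + j * n) div n) ((h + j * n) mod n))"
      using sum.shift_bounds_nat_ivl[of "\<lambda>l. F (l div n) (l mod n)" 0 "j * n" n]
      by (simp add: add.commute)
    also have "\<dots> = (\<Sum>h = 0..<n. F j h)" by (rule sum.cong) auto
    finally show "(\<Sum>l = j * n..<j * n + n. F (l div n) (l mod n)) = (\<Sum>h<n. F j h)"
      by (simp add: lessThan_atLeast0)
  qed simp
  finally show ?thesis .
qed

lemma bij_betw_div_mod:
  fixes t n :: nat
  assumes n: "n > 0"
  shows "bij_betw (\<lambda>k. (k div n, k mod n)) {0..<t * n} ({0..<t} \<times> {0..<n})"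
proof (rule bij_betw_byWitness[where f' = "\<lambda>(i, h). i * n + h"])
  show "(\<lambda>k. (k div n, k mod n)) ` {0..<t * n} \<subseteq> {0..<t} \<times> {0..<n}"
    using n by (auto simp: less_mult_imp_div_less)
  have "i * n + h < t * n" if "i < t" "h < n" for i h
  proof -
    have "i * n + h < Suc i * n" using that by simp
    also have "\<dots> \<le> t * n" using that by (intro mult_right_mono) auto
    finally show ?thesis .
  qed
  then show "(\<lambda>(i, h). i * n + h) ` ({0..<t} \<times> {0..<n}) \<subseteq> {0..<t * n}" by auto
  show "\<forall>k \<in> {0..<t * n}. (case (k div n, k mod n) of (i, h) \<Rightarrow> i * n + h) = k" by simp
  show "\<forall>x \<in> {0..<t} \<times> {0..<n}. ((case x of (i, h) \<Rightarrow> i * n + h) div n,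
      (case x of (i, h) \<Rightarrow> i * n + h) mod n) = x"
    using n by (auto simp: div_mult_self3 mod_mult_self3)
qed

definition cycle_skew :: "nat \<Rightarrow> nat \<Rightarrow> nat \<Rightarrow> real" where
  "cycle_skew t i j = (if j = (i + 1) mod t then 1 else 0) - (if i = (j + 1) mod t then 1 else 0)"

text \<open>Index \<open>k\<close> stands for the vertex \<open>(k div n, k mod n)\<close>. The
  factor \<open>h - h'\<close> vanishes only for equal heights, which is the pattern of the complete
  graph, and a product of two skew factors is symmetric.\<close>

definition skew_tensor :: "nat \<Rightarrow> nat \<Rightarrow> real mat" where
  "skew_tensor t n = mat (t * n) (t * n) (\<lambda>(k, l).
     cycle_skew t (k div n) (l div n) * (real (k mod n) - real (l mod n)))"

text \<open>For \<open>t \<ge> 3\<close> no vertex is both successor and predecessor of another, so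
  the two indicators never cancel.\<close>

lemma cycle_skew_nonzero:
  assumes "t \<ge> 3" "i < t" "j < t"
  shows "cycle_skew t i j \<noteq> 0 \<longleftrightarrow> (i, j) \<in> parcs (cycle_graph t)"
proof -
  have m: "(k + 1) mod t = (if k = t - 1 then 0 else Suc k)" if "k < t" for k
    using that by auto
  show ?thesis
    using assms by (auto simp: cycle_skew_def cycle_graph_def m[unfolded Suc_eq_plus1[symmetric]] split: if_splits)
qed

lemma skew_tensor_symmetric_mats:
  assumes t: "t \<ge> 3" and n: "n > 0"
  shows "skew_tensor t n \<in> symmetric_mats (cycle_complete_graph t n)"
proof -
  let ?f = "\<lambda>k. (k div n, k mod n)"
  have N: "card (pverts (cycle_complete_graph t n)) = t * n"
    by (simp add: pverts_cycle_complete)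
  have "bij_betw ?f {0..<t * n} (pverts (cycle_complete_graph t n))"
    unfolding pverts_cycle_complete by (rule bij_betw_div_mod[OF n])
  moreover have "described_by (cycle_complete_graph t n) ?f (skew_tensor t n)"
    unfolding described_by_def N
  proof (intro conjI allI impI)
    show "skew_tensor t n \<in> carrier_mat (t * n) (t * n)" by (simp add: skew_tensor_def)
    show "transpose_mat (skew_tensor t n) = skew_tensor t n"
      by (rule eq_matI) (auto simp: skew_tensor_def cycle_skew_def)
    fix i j assume ij: "i < t * n" "j < t * n" "i \<noteq> j"
    have "i div n < t" "j div n < t" using ij by (auto simp: less_mult_imp_div_less)
    then show "skew_tensor t n $$ (i, j) \<noteq> 0 \<longleftrightarrow> (?f i, ?f j) \<in> parcs (cycle_complete_graph t n)"
      using ij n cycle_skew_nonzero[OF t, of "i div n" "j div n"]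
      by (auto simp: skew_tensor_def tensor_graph_def complete_graph_def)
  qed
  ultimately show ?thesis by (auto simp: symmetric_mats_def N)
qed

text \<open>The sum is the value of \<open>p\<close> at the successor of \<open>i\<close> minus that
  at its predecessor \<open>k\<close>, and these positions are two apart.\<close>

lemma cycle_skew_sum:
  fixes p :: "nat \<Rightarrow> real"
  assumes t: "t \<ge> 3" and i: "i < t"
    and p: "\<And>i. i < t \<Longrightarrow> p ((i + 2) mod t) = p i"
  shows "(\<Sum>j<t. cycle_skew t i j * p j) = 0"
proof -
  define k where "k = (if i = 0 then t - 1 else i - 1)"
  have k: "k < t" "(k + 1) mod t = i" using t i by (auto simp: k_def)
  have u: "i = (j + 1) mod t \<longleftrightarrow> j = k" if "j < t" for j
    using that t i k by (auto simp: k_def mod_Suc split: if_splits)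
  have "(\<Sum>j<t. cycle_skew t i j * p j)
      = (\<Sum>j<t. (if j = (i + 1) mod t then p j else 0) - (if j = k then p j else 0))"
  proof (rule sum.cong)
    fix j assume "j \<in> {..<t}"
    then have "i = (j + 1) mod t \<longleftrightarrow> j = k" using u by simp
    then have "cycle_skew t i j = (if j = (i + 1) mod t then 1 else 0) - (if j = k then 1 else 0)"
      by (simp only: cycle_skew_def)
    then show "cycle_skew t i j * p j = (if j = (i + 1) mod t then p j else 0) - (if j = k then p j else 0)"
      by simp
  qed simp
  also have "\<dots> = p ((i + 1) mod t) - p k"
    using t k by (simp add: sum_subtractf)
  also have "(i + 1) mod t = (k + 2) mod t"
    unfolding k(2)[symmetric] by (simp add: mod_simps)
  finally show ?thesis using p[OF k(1)] by simp
qed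

text \<open>The shift by 2 modulo \<open>t\<close> is one cycle for odd \<open>t\<close> and two
  cycles, the parity classes, for even \<open>t\<close>. On each cycle one equation follows from the
  others.\<close>

lemma periodic_mod_cycle:
  fixes p :: "nat \<Rightarrow> 'a"
  assumes t: "t \<ge> 3"
    and p: "\<And>i. i < (if odd t then t - 1 else t - 2) \<Longrightarrow> p ((i + 2) mod t) = p i"
    and i: "i < t"
  shows "p ((i + 2) mod t) = p i"
proof -
  \<comment> \<open>The equations that do not wrap around already make \<open>p k\<close> depend
    only on the parity of \<open>k\<close>.\<close>
  have s: "p (k + 2) = p k" if "k + 2 < t" for k
  proof -
    have "k < (if odd t then t - 1 else t - 2)" using that by auto
    from p[OF this] show ?thesis using that by simp
  qed
  have e: "p k = p (k mod 2)" if "k < t" for k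
    using that
  proof (induction k rule: less_induct)
    case (less k)
    show ?case
    proof (cases "k < 2")
      case False
      then obtain l where l: "k = l + 2" using that[of "k - 2"] by simp
      then show ?thesis using less.IH[of l] less.prems s[of l] by simp
    qed simp
  qed
  show ?thesis
  proof (cases "i < (if odd t then t - 1 else t - 2)")
    case False
    show ?thesis
    proof (cases "odd t")
      case True
      then have i: "i = t - 1" using False i by auto
      have "(i + 2) mod t = 1" using i t by (simp add: mod_if)
      \<comment> \<open>For odd \<open>t\<close> this wrapping equation is among the assumed ones
        and identifies the odd class with the even class.\<close>
      moreover have "p (t - 2) = p 0"
      proof -
        have "t - 2 < (if odd t then t - 1 else t - 2)" "t - 2 + 2 = t" using True t by auto
        from p[OF this(1)] this(2) show ?thesis by simp
      qed
      moreover have "(t - 2) mod 2 = 1" using True t by presburger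
      moreover have "i mod 2 = 0" using True i by simp
      ultimately show ?thesis using e[of "t - 2"] e[of i] i t by simp
    next
      case even: False
      then have "i = t - 2 \<or> i = t - 1" using False i by auto
      then show ?thesis
      proof
        assume i: "i = t - 2"
        then have "i + 2 = t" "i mod 2 = 0" using t even by auto
        then show ?thesis using e[of i] by simp
      next
        assume i: "i = t - 1"
        then have "(i + 2) mod t = 1" using t by (simp add: mod_if)
        moreover have "i mod 2 = 1" using i t even by presburger
        ultimately show ?thesis using e[of i] i t by simp
      qed
    qed
  qed (rule p)
qed

text \<open>The \<open>2 * m\<close> equations in \<open>C\<close> suffice for membership in the
  kernel, so its codimension is at most \<open>2 * m\<close>.\<close>

lemma kernel_dim_skew_tensor:
  assumes t: "t \<ge> 3"
  shows "t * n \<le> 2 * (if odd t then t - 1 else t - 2) + kernel_dim (skew_tensor t n)"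
proof -
  define m where "m = (if odd t then t - 1 else t - 2)"
  have mt: "m \<le> t" by (auto simp: m_def)
  let ?w = "\<lambda>(k :: nat) h. if even k then 1 else real h"
  let ?\<delta> = "\<lambda>i j. if i = j then 1 else 0 :: real"
  \<comment> \<open>Row \<open>2 i\<close> is \<open>p\<^sub>i\<^sub>+\<^sub>2 - p\<^sub>i\<close> and row \<open>2 i + 1\<close> is \<open>q\<^sub>i\<^sub>+\<^sub>2 - q\<^sub>i\<close>.\<close>
  define C where "C = mat (2 * m) (t * n) (\<lambda>(k, l).
    ?w k (l mod n) * (?\<delta> (l div n) ((k div 2 + 2) mod t) - ?\<delta> (l div n) (k div 2)))"
  have C: "C \<in> carrier_mat (2 * m) (t * n)" by (simp add: C_def)
  have S: "skew_tensor t n \<in> carrier_mat (t * n) (t * n)" by (simp add: skew_tensor_def)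
  have "v \<in> mat_kernel (skew_tensor t n)" if vC: "v \<in> mat_kernel C" for v
  proof -
    from mat_kernelD[OF C vC] have v: "v \<in> carrier_vec (t * n)" and Cv: "C *\<^sub>v v = 0\<^sub>v (2 * m)" by auto
    \<comment> \<open>Only the parity of \<open>k\<close> matters: \<open>p 0\<close> holds the
      column sums, \<open>p 1\<close> the sums weighted by height.\<close>
    define p where "p = (\<lambda>k j. \<Sum>h<n. ?w k h * v $ (j * n + h))"
    have per: "p k ((k div 2 + 2) mod t) = p k (k div 2)" if k: "k < 2 * m" for k
    proof -
      have kt: "k div 2 < t" "(k div 2 + 2) mod t < t" using k mt t by auto
      have "0 = (C *\<^sub>v v) $ k" using Cv k by simp
      also have "\<dots> = (\<Sum>l = 0..<t * n. ?w k (l mod n) *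
          (?\<delta> (l div n) ((k div 2 + 2) mod t) - ?\<delta> (l div n) (k div 2)) * v $ (l div n * n + l mod n))"
        using v k by (simp add: C_def scalar_prod_def)
      also have "\<dots> = (\<Sum>j<t. \<Sum>h<n. ?w k h *
          (?\<delta> j ((k div 2 + 2) mod t) - ?\<delta> j (k div 2)) * v $ (j * n + h))"
        by (rule sum_div_mod)
      also have "\<dots> = (\<Sum>j<t. (?\<delta> j ((k div 2 + 2) mod t) - ?\<delta> j (k div 2)) * p k j)"
        by (simp add: p_def sum_distrib_left mult.assoc mult.left_commute)
      also have "\<dots> = (\<Sum>j<t. (if j = (k div 2 + 2) mod t then p k j else 0) - (if j = k div 2 then p k j else 0))"
        by (rule sum.cong) auto
      also have "\<dots> = p k ((k div 2 + 2) mod t) - p k (k div 2)"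
        using kt by (simp add: sum_subtractf)
      finally show ?thesis by simp
    qed
    have p0: "p 0 ((i + 2) mod t) = p 0 i" if "i < t" for i
    proof (rule periodic_mod_cycle[OF t _ that])
      fix i assume "i < (if odd t then t - 1 else t - 2)"
      then show "p 0 ((i + 2) mod t) = p 0 i" using per[of "2 * i"] by (simp add: m_def p_def)
    qed
    have p1: "p 1 ((i + 2) mod t) = p 1 i" if "i < t" for i
    proof (rule periodic_mod_cycle[OF t _ that])
      fix i assume "i < (if odd t then t - 1 else t - 2)"
      then show "p 1 ((i + 2) mod t) = p 1 i" using per[of "2 * i + 1"] by (simp add: m_def p_def)
    qed
    have "(skew_tensor t n *\<^sub>v v) $ k = 0" if k: "k < t * n" for k
    proof -
      let ?i = "k div n" and ?h = "real (k mod n)"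
      have i: "?i < t" using k by (simp add: less_mult_imp_div_less)
      have "(skew_tensor t n *\<^sub>v v) $ k = (\<Sum>l = 0..<t * n.
          cycle_skew t ?i (l div n) * (?h - real (l mod n)) * v $ (l div n * n + l mod n))"
        using v k by (simp add: skew_tensor_def scalar_prod_def)
      also have "\<dots> = (\<Sum>j<t. \<Sum>h<n. cycle_skew t ?i j * (?h - real h) * v $ (j * n + h))"
        by (rule sum_div_mod)
      \<comment> \<open>The rank 2 factor splits: the height of the row multiplies the plain sums,
        and the weighted sums are subtracted.\<close>
      also have "\<dots> = (\<Sum>j<t. ?h * (cycle_skew t ?i j * p 0 j) - cycle_skew t ?i j * p 1 j)"
        by (simp add: p_def sum_distrib_left sum_subtractf algebra_simps)
      also have "\<dots> = ?h * (\<Sum>j<t. cycle_skew t ?i j * p 0 j) - (\<Sum>j<t. cycle_skew t ?i j * p 1 j)"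
        by (simp add: sum_subtractf sum_distrib_left)
      also have "\<dots> = 0" using cycle_skew_sum[OF t i, of "p 0"] cycle_skew_sum[OF t i, of "p 1"] p0 p1 by simp
      finally show ?thesis .
    qed
    then have "skew_tensor t n *\<^sub>v v = 0\<^sub>v (t * n)"
      using S by (intro eq_vecI) auto
    then show ?thesis using mat_kernelI[OF S v] by simp
  qed
  \<comment> \<open>The matrix without rows has the whole space as kernel, so the general inequality
    starts from dimension \<open>t * n\<close>.\<close>
  then have "mat_kernel (0\<^sub>m 0 (t * n)) \<inter> mat_kernel C \<subseteq> mat_kernel (skew_tensor t n)" by blast
  from kernel_dim_le_add_rows[OF zero_carrier_mat C S this]
  have "kernel_dim (0\<^sub>m 0 (t * n) :: real mat) \<le> 2 * m + kernel_dim (skew_tensor t n)" .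
  moreover have "kernel_dim (0\<^sub>m 0 (t * n) :: real mat) = t * n"
  proof -
    interpret K: kernel 0 "t * n" "0\<^sub>m 0 (t * n) :: real mat" by unfold_locales simp
    have "mat_kernel (0\<^sub>m 0 (t * n) :: real mat) = carrier_vec (t * n)"
      by (auto simp: mat_kernel_def)
    then have "K.VK = K.NC.V" by (simp add: module_vec_def)
    then show ?thesis using K.NC.dim_is_n by simp
  qed
  ultimately show ?thesis by (simp add: m_def)
qed

section \<open>Agreement of the two bounds\<close>

theorem theorem2p5:
  fixes n t :: nat
  assumes "n \<ge> 3" and "t \<ge> 3"
  shows "max_nullity (tensor_graph (cycle_graph t) (complete_graph n))
           = zero_forcing_number (tensor_graph (cycle_graph t) (complete_graph n))
       \<and> zero_forcing_number (tensor_graph (cycle_graph t) (complete_graph n))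
           = (if odd t then (n - 2) * t + 2 else (n - 2) * t + 4)"
proof -
  let ?G = "cycle_complete_graph t n"
  let ?k = "if odd t then (n - 2) * t + 2 else (n - 2) * t + 4"
  have n: "n \<ge> 2" "n > 0" using assms by auto
  note t = assms(2)
  obtain a b where ab: "t = a + 3" "n = b + 2" using that[of "t - 3" "n - 2"] t n by simp
  \<comment> \<open>The claimed value is \<open>t * n\<close> minus the number of equations imposed
    on the kernel.\<close>
  have "?k + 2 * (if odd t then t - 1 else t - 2) = t * n"
    unfolding ab by (simp add: algebra_simps)
  then have k: "?k \<le> kernel_dim (skew_tensor t n)"
    using kernel_dim_skew_tensor[OF t, of n] by linarith
  obtain B where B: "zero_forcing_set ?G B" "card B = ?k"
  proof (cases "odd t")
    case True
    then show ?thesis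
      using that[OF zero_forcing_set_alternating[OF t True n(1)]] card_zero_forcing_set_alternating[OF t n(1)] by simp
  next
    case False
    then show ?thesis
      using that[OF zero_forcing_set_two_columns[OF t n(1)]] card_zero_forcing_set_two_columns[OF t n(1)] by simp
  qed
  from max_nullity_eq_zero_forcing_numberI[OF pair_graph_cycle_complete[OF t]
      skew_tensor_symmetric_mats[OF t n(2)] B(1) _ k] B(2)
  show ?thesis by simp
qed

end
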